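(* Let $D\subseteq\mathbb{R}$, let $f:D\to\mathbb{R}$ be a real-valued function, let $C=[(\underline{c}_L,\overline{c}_L),(\underline{c}_U,\overline{c}_U)]\in I_2(\mathbb{R})$, and let $F_2:D\to I_2(\mathbb{R})$ be given by $F_2(x)=C f(x)$. Let $x_o$ be a limit point of $D$. If $\lim_{x\to x_o}f(x)$ exists, then $\lim_{x\to x_o}F_2(x)$ exists and $$\lim_{x\to x_o}F_2(x)=C\cdot\lim_{x\to x_o}f(x).$$
   Context: A Type-2 interval is given by four real numbers $\underline{a}_L\le\overline{a}_L\le\underline{a}_U\le\overline{a}_U$ and is written $A=[(\underline{a}_L,\overline{a}_L),(\underline{a}_U,\overline{a}_U)]$; $I_2(\mathbb{R})$ denotes the set of all Type-2 intervals, with equality meaning equality of the four corresponding entries. For $\lambda\in\mathbb{R}$, the scalar multiple $\lambda A=A\lambda$ is $[(\lambda\underline{a}_L,\lambda\overline{a}_L),(\lambda\underline{a}_U,\lambda\overline{a}_U)]$ if $\lambda\ge0$ and $[(\lambda\overline{a}_U,\lambda\underline{a}_U),(\lambda\overline{a}_L,\lambda\underline{a}_L)]$ if $\lambda<0$. The extended Moore distance is $$D_{M_2}(X,Y)=\max\{|\underline{x}_L-\underline{y}_L|,\ |\overline{x}_L-\overline{y}_L|,\ |\underline{x}_U-\underline{y}_U|,\ |\overline{x}_U-\overline{y}_U|\}.$$ For $F_2:D\to I_2(\mathbb{R})$, a limit point $x_o$ of $D$ and $L\in I_2(\mathbb{R})$, $\lim_{x\to x_o}F_2(x)=L$ means: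 for every $\varepsilon>0$ there is $\delta>0$ such that $D_{M_2}(F_2(x),L)<\varepsilon$ for all $x\in D$ with $0<|x-x_o|<\delta$. Limits of real functions are finite limits. *)

theory Defs
  imports "HOL-Analysis.Analysis"
begin

text \<open>The tuple \<open>(a, b, c, d)\<close> stands for the Type-2 interval \<open>[(a, b), (c, d)]\<close>.\<close>

typedef t2_interval =
  "{(a, b, c, d). a \<le> b \<and> b \<le> c \<and> c \<le> d} :: (real \<times> real \<times> real \<times> real) set"
  by (rule exI[of _ "(0, 0, 0, 0)"]) simp

setup_lifting type_definition_t2_interval

lift_definition lowerL :: "t2_interval \<Rightarrow> real" is "\<lambda>(a, b, c, d). a" .
lift_definition upperL :: "t2_interval \<Rightarrow> real" is "\<lambda>(a, b, c, d). b" .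
lift_definition lowerU :: "t2_interval \<Rightarrow> real" is "\<lambda>(a, b, c, d). c" .
lift_definition upperU :: "t2_interval \<Rightarrow> real" is "\<lambda>(a, b, c, d). d" .

lemma t2_interval_eq_iff:
  "A = B \<longleftrightarrow> lowerL A = lowerL B \<and> upperL A = upperL B \<and> lowerU A = lowerU B \<and> upperU A = upperU B"
  by transfer auto

text \<open>A negative scalar reverses the order of the four entries.\<close>

lift_definition t2_scale :: "real \<Rightarrow> t2_interval \<Rightarrow> t2_interval" is
  "\<lambda>r (a, b, c, d). if r \<ge> 0 then (r * a, r * b, r * c, r * d) else (r * d, r * c, r * b, r * a)"
  by (auto simp: mult_left_mono mult_left_mono_neg split: if_splits)

definition moore_dist2 :: "t2_interval \<Rightarrow> t2_interval \<Rightarrow> real" where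
  "moore_dist2 X Y =
    Max {\<bar>lowerL X - lowerL Y\<bar>, \<bar>upperL X - upperL Y\<bar>, \<bar>lowerU X - lowerU Y\<bar>, \<bar>upperU X - upperU Y\<bar>}"

text \<open>\<open>t2_has_limit F D x0 L\<close> says that \<open>F\<close>, restricted to \<open>D\<close>, has limit \<open>L\<close> at \<open>x0\<close>;
  the values of \<open>F\<close> outside \<open>D\<close> are irrelevant.\<close>

definition t2_has_limit :: "(real \<Rightarrow> t2_interval) \<Rightarrow> real set \<Rightarrow> real \<Rightarrow> t2_interval \<Rightarrow> bool" where
  "t2_has_limit F D x0 L \<longleftrightarrow>
    (\<forall>\<epsilon>>0. \<exists>\<delta>>0. \<forall>x\<in>D. 0 < \<bar>x - x0\<bar> \<and> \<bar>x - x0\<bar> < \<delta> \<longrightarrow> moore_dist2 (F x) L < \<epsilon>)"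

end

theory Submission
  imports Defs
begin

text \<open>Each entry of \<open>t2_scale r C\<close> is a continuous function of \<open>r\<close>: the two branches of the
  definition agree at \<open>r = 0\<close>, so both are captured by
  \<open>max r 0 * p + min r 0 * q\<close>. A Type-2 limit is an entrywise limit.\<close>

lemma t2_scale_entries:
  "lowerL (t2_scale r C) = max r 0 * lowerL C + min r 0 * upperU C"
  "upperL (t2_scale r C) = max r 0 * upperL C + min r 0 * lowerU C"
  "lowerU (t2_scale r C) = max r 0 * lowerU C + min r 0 * upperL C"
  "upperU (t2_scale r C) = max r 0 * upperU C + min r 0 * lowerL C"
  by (transfer, auto simp: max_def min_def)+

lemma t2_has_limit_entrywise:
  assumes "((\<lambda>x. lowerL (F x)) \<longlongrightarrow> lowerL L) (at x0 within D)"
    and "((\<lambda>x. upperL (F x)) \<longlongrightarrow> upperL L) (at x0 within D)"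
    and "((\<lambda>x. lowerU (F x)) \<longlongrightarrow> lowerU L) (at x0 within D)"
    and "((\<lambda>x. upperU (F x)) \<longlongrightarrow> upperU L) (at x0 within D)"
  shows "t2_has_limit F D x0 L"
  unfolding t2_has_limit_def
proof (intro allI impI)
  fix \<epsilon> :: real
  assume "\<epsilon> > 0"
  \<comment> \<open>Each entry is eventually within \<open>\<epsilon>\<close> of its limit. Four
    eventual bounds hold jointly, and a finite maximum is below \<open>\<epsilon>\<close> once all
    its members are.\<close>
  from assms[THEN tendstoD, OF this]
  have "\<forall>\<^sub>F x in at x0 within D. moore_dist2 (F x) L < \<epsilon>"
    by eventually_elim (simp add: moore_dist2_def dist_real_def)
  then show "\<exists>\<delta>>0. \<forall>x\<in>D. 0 < \<bar>x - x0\<bar> \<and> \<bar>x - x0\<bar> < \<delta> \<longrightarrow> moore_dist2 (F x) L < \<epsilon>"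
    by (auto simp: eventually_at dist_real_def)
qed

text \<open>Needed because \<open>F2\<close> is tied to the scaled form only on \<open>D\<close>,
  while the functions are total.\<close>

lemma t2_has_limit_cong:
  assumes "\<And>x. x \<in> D \<Longrightarrow> F x = G x"
  shows "t2_has_limit F D x0 L \<longleftrightarrow> t2_has_limit G D x0 L"
  using assms by (simp add: t2_has_limit_def)

text \<open>The \<open>max\<close>/\<open>min\<close> form avoids a case split on the sign of
  \<open>l\<close>; in particular \<open>f\<close> may change sign arbitrarily near
  \<open>x0\<close> when \<open>l = 0\<close>.\<close>

lemma t2_has_limit_scale:
  assumes "(f \<longlongrightarrow> l) (at x0 within D)"
  shows "t2_has_limit (\<lambda>x. t2_scale (f x) C) D x0 (t2_scale l C)"
  by (rule t2_has_limit_entrywise; unfold t2_scale_entries; intro tendsto_intros assms)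

theorem theorem6p2:
  fixes D :: "real set" and f :: "real \<Rightarrow> real" and C :: t2_interval
    and F2 :: "real \<Rightarrow> t2_interval" and x0 :: real
  assumes "\<And>x. x \<in> D \<Longrightarrow> F2 x = t2_scale (f x) C"
    and "x0 islimpt D"
    and "\<exists>l. (f \<longlongrightarrow> l) (at x0 within D)"
  shows "(\<exists>L. t2_has_limit F2 D x0 L) \<and>
    t2_has_limit F2 D x0 (t2_scale (Lim (at x0 within D) f) C)"
proof -
  obtain l where l: "(f \<longlongrightarrow> l) (at x0 within D)"
    using assms(3) by blast
  \<comment> \<open>A limit point makes the filter \<open>at x0 within D\<close> nontrivial, so
    limits are unique and the choice operator behind \<open>Lim\<close> must return
    \<open>l\<close>.\<close>
  moreover have "Lim (at x0 within D) f = l"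
    using assms(2) l by (intro tendsto_Lim) (simp_all add: trivial_limit_within)
  ultimately have "t2_has_limit F2 D x0 (t2_scale (Lim (at x0 within D) f) C)"
    using t2_has_limit_scale[of f l x0 D C] t2_has_limit_cong[OF assms(1)] by simp
  then show ?thesis
    by blast
qed

end
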